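(* Let $J \subset \mathbb{R}$ be a closed bounded interval and let $f : J \to J$ be a continuous function. If $f$ has an orbit of period three, then for every positive integer $m$, $f$ has an orbit of period $m$.
   Context: For a positive integer $n$, an orbit (or cycle) of period $n$ of $f$ is a set $\{x, f(x), \ldots, f^{n-1}(x)\}$ with exactly $n$ distinct points and $f^n(x)=x$; equivalently $f^n(x)=x$ and $f^k(x)\neq x$ for $0<k<n$ (so "period" means least period). Here $f^k$ is the $k$-fold iterate of $f$. *)

theory Defs
  imports Complex_Main
begin

text \<open>Self-maps of a subset \<open>S\<close> are total functions that map \<open>S\<close> into itself; only orbits of points
  of \<open>S\<close> count. The cardinality condition makes \<open>n\<close> the least period.\<close>

definition periodic_orbit_on :: "'a set \<Rightarrow> ('a \<Rightarrow> 'a) \<Rightarrow> nat \<Rightarrow> 'a set \<Rightarrow> bool" where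
  "periodic_orbit_on S f n C \<longleftrightarrow>
     n > 0 \<and> (\<exists>x\<in>S. C = (\<lambda>k. (f ^^ k) x) ` {..<n} \<and> card C = n \<and> (f ^^ n) x = x)"

definition has_orbit_of_period_on :: "'a set \<Rightarrow> ('a \<Rightarrow> 'a) \<Rightarrow> nat \<Rightarrow> bool" where
  "has_orbit_of_period_on S f n \<longleftrightarrow> (\<exists>C. periodic_orbit_on S f n C)"

end

theory Submission
  imports Defs
begin

text \<open>
  The middle point \<open>q\<close> of a 3-cycle lies between \<open>f q\<close> and \<open>f (f q)\<close>. Let \<open>L\<close> and \<open>K\<close> be the intervals
  joining \<open>q\<close> to \<open>f q\<close> and to \<open>f (f q)\<close>. By the intermediate value theorem \<open>f ` K\<close> contains \<open>L\<close> and
  \<open>f ` L\<close> contains \<open>K \<union> L\<close>. Pulling intervals back along the loop \<open>K \<rightarrow> L \<rightarrow> \<dots> \<rightarrow> L \<rightarrow> K\<close> of length \<open>m\<close>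
  gives a subinterval of \<open>K\<close> that \<open>f ^^ m\<close> maps onto \<open>K\<close>, hence a fixed point \<open>x\<close> of \<open>f ^^ m\<close> that starts
  in \<open>K\<close> and then stays in \<open>L\<close>. A smaller period would put \<open>x\<close> into \<open>K \<inter> L = {q}\<close>, but the orbit of \<open>q\<close>
  does not follow this itinerary.
\<close>

text \<open>Intermediate value theorem in a form with unordered endpoints, so that mirror-image
  positions of the points need no separate treatment.\<close>

lemma interval_image_subset:
  fixes f :: "real \<Rightarrow> real"
  assumes "continuous_on {min x y..max x y} f"
  shows "{min (f x) (f y)..max (f x) (f y)} \<subseteq> f ` {min x y..max x y}"
proof -
  have "connected (f ` {min x y..max x y})"
    using assms by (intro connected_continuous_image) auto
  moreover have "f x \<in> f ` {min x y..max x y}" "f y \<in> f ` {min x y..max x y}"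
    by auto
  ultimately show ?thesis
    unfolding connected_iff_interval subset_iff by (metis atLeastAtMost_iff max_def min_def)
qed

text \<open>Let \<open>d\<close> be the first point with value \<open>f v\<close>, and
  \<open>c\<close> the last point before \<open>d\<close> with value \<open>f u\<close>. Both exist
  because level sets are compact, and between them \<open>f\<close> cannot leave the range from
  \<open>f u\<close> to \<open>f v\<close>.\<close>

lemma exists_subinterval_image_eq_mono:
  fixes f :: "real \<Rightarrow> real"
  assumes "u \<le> v" "continuous_on {u..v} f" "f u \<le> f v"
  shows "\<exists>c d. u \<le> c \<and> c \<le> d \<and> d \<le> v \<and> f ` {c..d} = {f u..f v}"
proof -
  have compact_level: "compact {x \<in> {s..t}. f x = y}" if "{s..t} \<subseteq> {u..v}" for s t y
  proof -
    have "closed (f -` {y} \<inter> {s..t})"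
      using continuous_on_subset[OF assms(2) that]
        continuous_on_closed_vimage[OF closed_atLeastAtMost, of s t f] closed_singleton[of y] by simp
    moreover have "{x \<in> {s..t}. f x = y} = {s..t} \<inter> (f -` {y} \<inter> {s..t})"
      by auto
    ultimately show ?thesis
      by (simp add: compact_Int_closed)
  qed
  obtain d where d: "d \<in> {u..v}" "f d = f v" and
      d_min: "\<And>x. x \<in> {u..v} \<Longrightarrow> f x = f v \<Longrightarrow> d \<le> x"
    using compact_attains_inf[OF compact_level[of u v "f v"]] \<open>u \<le> v\<close> by fastforce
  obtain c where c: "c \<in> {u..d}" "f c = f u" and
      c_max: "\<And>x. x \<in> {u..d} \<Longrightarrow> f x = f u \<Longrightarrow> x \<le> c"
    using compact_attains_sup[OF compact_level[of u d "f u"]] d(1) by fastforce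
  have cont: "continuous_on {s..t} f" if "c \<le> s" "t \<le> d" for s t
    using that c d by (intro continuous_on_subset[OF assms(2)]) auto
  have "f ` {c..d} \<subseteq> {f u..f v}"
  proof clarify
    fix x assume x: "x \<in> {c..d}"
    \<comment> \<open>A dip below \<open>f u\<close> at \<open>x\<close> would force the value
      \<open>f u\<close> again between \<open>x\<close> and \<open>d\<close>, against the choice of
      \<open>c\<close>.\<close>
    have "f u \<le> f x"
    proof (rule ccontr)
      assume less: "\<not> f u \<le> f x"
      then obtain z where z: "x \<le> z" "z \<le> d" "f z = f u"
        using IVT'[of f x "f u" d] x d assms(3) cont[of x d] by auto
      then have "x = c"
        using c_max[of z] x c by auto
      then show False
        using less c by simp
    qed
    moreover have "f x \<le> f v"
    proof (rule ccontr)
      assume less: "\<not> f x \<le> f v"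
      then obtain z where z: "c \<le> z" "z \<le> x" "f z = f v"
        using IVT'[of f c "f v" x] x c assms(3) cont[of c x] by auto
      then have "x = d"
        using d_min[of z] x c d by auto
      then show False
        using less d by simp
    qed
    ultimately show "f x \<in> {f u..f v}"
      by simp
  qed
  moreover have "{f u..f v} \<subseteq> f ` {c..d}"
    using interval_image_subset[of c d f] cont[of c d] c d assms(3) by auto
  ultimately show ?thesis
    using c d by auto
qed

text \<open>Preimages of \<open>c\<close> and \<open>d\<close> may occur in either order; the
  reversed order reduces to the other one by passing to \<open>-f\<close>.\<close>

lemma exists_subinterval_image_eq:
  fixes f :: "real \<Rightarrow> real"
  assumes "continuous_on {a..b} f" "{c..d} \<subseteq> f ` {a..b}" "c \<le> d"
  obtains s t where "a \<le> s" "s \<le> t" "t \<le> b" "f ` {s..t} = {c..d}"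
proof -
  obtain u v where uv: "u \<in> {a..b}" "v \<in> {a..b}" "f u = c" "f v = d"
    using assms(2,3) by (smt (verit) atLeastAtMost_iff imageE subsetD)
  show ?thesis
  proof (cases "u \<le> v")
    case True
    have "continuous_on {u..v} f"
      using uv by (intro continuous_on_subset[OF assms(1)]) auto
    then obtain s t where "u \<le> s" "s \<le> t" "t \<le> v" "f ` {s..t} = {c..d}"
      using exists_subinterval_image_eq_mono[of u v f] uv(3,4) assms(3) True by auto
    then show ?thesis
      using uv(1,2) that[of s t] by auto
  next
    case False
    have "continuous_on {v..u} (\<lambda>x. - f x)"
      using uv by (intro continuous_on_minus continuous_on_subset[OF assms(1)]) auto
    then obtain s t where st: "v \<le> s" "s \<le> t" "t \<le> u" "(\<lambda>x. - f x) ` {s..t} = {-d..-c}"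
      using exists_subinterval_image_eq_mono[of v u "\<lambda>x. - f x"] uv assms(3) False by auto
    have "f ` {s..t} = uminus ` (\<lambda>x. - f x) ` {s..t}"
      by (simp add: image_image)
    also have "\<dots> = {c..d}"
      using st by simp
    finally show ?thesis
      using st uv that[of s t] by auto
  qed
qed

text \<open>At preimages \<open>u\<close> of \<open>a\<close> and \<open>v\<close> of
  \<open>b\<close>, the difference \<open>g x - x\<close> is nonpositive and nonnegative
  respectively, so it vanishes in between.\<close>

lemma exists_fixed_point_of_interval_subset_image:
  fixes g :: "real \<Rightarrow> real"
  assumes "continuous_on {a..b} g" "{a..b} \<subseteq> g ` {a..b}" "a \<le> b"
  obtains x where "x \<in> {a..b}" "g x = x"
proof -
  obtain u v where uv: "u \<in> {a..b}" "v \<in> {a..b}" "g u = a" "g v = b"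
    using assms(2,3) by (smt (verit) atLeastAtMost_iff imageE subsetD)
  have "continuous_on {min u v..max u v} (\<lambda>x. g x - x)"
    using uv by (intro continuous_intros continuous_on_subset[OF assms(1)]) auto
  from interval_image_subset[OF this]
  have "0 \<in> (\<lambda>x. g x - x) ` {min u v..max u v}"
    using uv by auto
  then obtain x where "x \<in> {min u v..max u v}" "g x = x"
    by auto
  then show ?thesis
    using uv(1,2) that[of x] by (auto simp: min_def max_def split: if_splits)
qed

lemma continuous_on_funpow:
  fixes f :: "'a::topological_space \<Rightarrow> 'a"
  assumes "continuous_on J f" "f ` J \<subseteq> J"
  shows "continuous_on J (f ^^ n) \<and> (f ^^ n) ` J \<subseteq> J"
proof (induction n)
  case (Suc n)
  then have "continuous_on J (f \<circ> f ^^ n)"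
    using continuous_on_subset[OF assms(1)] by (intro continuous_on_compose) auto
  then show ?case
    using Suc assms(2) by (auto simp: o_def)
qed auto

text \<open>Induction from the far end: the shifted itinerary yields an interval inside the second
  one, which is then pulled back through a single application of \<open>f\<close>.\<close>

lemma exists_interval_following_itinerary:
  fixes f :: "real \<Rightarrow> real" and l r :: "nat \<Rightarrow> real"
  assumes "\<And>i. i \<le> n \<Longrightarrow> l i \<le> r i"
    and "\<And>i. i < n \<Longrightarrow> continuous_on {l i..r i} f"
    and "\<And>i. i < n \<Longrightarrow> {l (Suc i)..r (Suc i)} \<subseteq> f ` {l i..r i}"
  shows "\<exists>s t. s \<le> t \<and> {s..t} \<subseteq> {l 0..r 0} \<and> (\<forall>i\<le>n. (f ^^ i) ` {s..t} \<subseteq> {l i..r i})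
           \<and> (f ^^ n) ` {s..t} = {l n..r n}"
  using assms
proof (induction n arbitrary: l r)
  case 0
  then show ?case
    by (intro exI[of _ "l 0"] exI[of _ "r 0"]) auto
next
  case (Suc n)
  obtain s t where st: "s \<le> t" "{s..t} \<subseteq> {l 1..r 1}"
      "\<And>i. i \<le> n \<Longrightarrow> (f ^^ i) ` {s..t} \<subseteq> {l (Suc i)..r (Suc i)}"
      "(f ^^ n) ` {s..t} = {l (Suc n)..r (Suc n)}"
    using Suc.IH[of "\<lambda>i. l (Suc i)" "\<lambda>i. r (Suc i)"] Suc.prems by auto
  have "{s..t} \<subseteq> f ` {l 0..r 0}"
    using order_trans[OF st(2)] Suc.prems(3)[of 0] by simp
  then obtain s' t' where st': "l 0 \<le> s'" "s' \<le> t'" "t' \<le> r 0" "f ` {s'..t'} = {s..t}"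
    using exists_subinterval_image_eq[of "l 0" "r 0" f s t] Suc.prems(2)[of 0] st(1) by auto
  have image_Suc: "(f ^^ Suc i) ` {s'..t'} = (f ^^ i) ` {s..t}" for i
    by (simp only: funpow_Suc_right image_comp[symmetric] st'(4))
  have "(f ^^ i) ` {s'..t'} \<subseteq> {l i..r i}" if "i \<le> Suc n" for i
  proof (cases i)
    case 0
    then show ?thesis
      using st' by auto
  next
    case (Suc j)
    then show ?thesis
      using that st(3)[of j] image_Suc[of j] by simp
  qed
  then show ?case
    using st st' image_Suc[of n] by (intro exI[of _ s'] exI[of _ t']) auto
qed

lemma has_orbit_of_period_onI:
  assumes "n > 0" "x \<in> S" "(f ^^ n) x = x" and least: "\<And>k. 0 < k \<Longrightarrow> k < n \<Longrightarrow> (f ^^ k) x \<noteq> x"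
  shows "has_orbit_of_period_on S f n"
proof -
  have "(f ^^ i) x \<noteq> (f ^^ j) x" if "i < j" "j < n" for i j
  proof
    assume "(f ^^ i) x = (f ^^ j) x"
    \<comment> \<open>Applying \<open>f ^^ (n - j)\<close> turns the coincidence into a return to
      \<open>x\<close> after fewer than \<open>n\<close> steps.\<close>
    then have "(f ^^ (n - j + i)) x = (f ^^ (n - j + j)) x"
      by (simp only: funpow_add o_apply)
    then show False
      using least[of "n - j + i"] that assms(3) by (simp add: less_diff_conv2)
  qed
  then have "inj_on (\<lambda>k. (f ^^ k) x) {..<n}"
    by (intro linorder_inj_onI) auto
  then have "card ((\<lambda>k. (f ^^ k) x) ` {..<n}) = n"
    by (simp add: card_image)
  then show ?thesis
    unfolding has_orbit_of_period_on_def periodic_orbit_on_def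
    using assms(1-3) by blast
qed

lemma has_orbit_of_period_on_3E:
  assumes "has_orbit_of_period_on S f 3"
  obtains x where "x \<in> S" "f (f (f x)) = x" "x \<noteq> f x" "f x \<noteq> f (f x)" "f (f x) \<noteq> x"
proof -
  obtain x where x: "x \<in> S" "card ((\<lambda>k. (f ^^ k) x) ` {..<3}) = 3" "(f ^^ 3) x = x"
    using assms unfolding has_orbit_of_period_on_def periodic_orbit_on_def by auto
  have "(\<lambda>k. (f ^^ k) x) ` {..<3} = {x, f x, f (f x)}"
    by (auto simp: numeral_3_eq_3 lessThan_Suc)
  with x(2) have "card {x, f x, f (f x)} = 3"
    by simp
  then show ?thesis
    using that x(1,3) by (auto simp: numeral_3_eq_3 card_insert_if split: if_splits)
qed

text \<open>One of three distinct reals lies between the others, and any point of the cycle may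
  serve as its start.\<close>

lemma has_orbit_of_period_on_3_middleE:
  fixes f :: "'a::linorder \<Rightarrow> 'a"
  assumes "has_orbit_of_period_on S f 3" "f ` S \<subseteq> S"
  obtains q where "q \<in> S" "f (f (f q)) = q" "f q < q \<and> q < f (f q) \<or> f (f q) < q \<and> q < f q"
proof -
  obtain x where x: "x \<in> S" "f (f (f x)) = x" "x \<noteq> f x" "f x \<noteq> f (f x)" "f (f x) \<noteq> x"
    using assms(1) by (rule has_orbit_of_period_on_3E)
  have "f x \<in> S" "f (f x) \<in> S"
    using x(1) assms(2) by auto
  then show ?thesis
    using x that[of x] that[of "f x"] that[of "f (f x)"] by (metis linorder_neqE)
qed

theorem theorem5:
  fixes a b :: real and J :: "real set" and f :: "real \<Rightarrow> real"
  assumes "a \<le> b" and "J = {a..b}"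
    and "f ` J \<subseteq> J"
    and "continuous_on J f"
    and "has_orbit_of_period_on J f 3"
  shows "\<forall>m::nat. m > 0 \<longrightarrow> has_orbit_of_period_on J f m"
proof (intro allI impI)
  fix m :: nat
  assume "m > 0"
  obtain q where q: "q \<in> J" "f (f (f q)) = q"
      and middle: "f q < q \<and> q < f (f q) \<or> f (f q) < q \<and> q < f q"
    using has_orbit_of_period_on_3_middleE assms(3,5) by blast
  have in_J: "f q \<in> J" "f (f q) \<in> J"
    using q assms(3) by auto
  define L where "L = {min q (f q)..max q (f q)}"
  define K where "K = {min q (f (f q))..max q (f (f q))}"
  have sub: "K \<subseteq> J" "L \<subseteq> J"
    using q in_J assms(2) unfolding K_def L_def by auto
  then have cont: "continuous_on K f" "continuous_on L f"
    using continuous_on_subset[OF assms(4)] by simp_all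
  \<comment> \<open>The endpoints \<open>q\<close> and \<open>f (f q)\<close> of \<open>K\<close> go
    to \<open>f q\<close> and \<open>q\<close>.\<close>
  have LK: "L \<subseteq> f ` K"
    using interval_image_subset[of q "f (f q)" f] cont q(2)
    unfolding K_def L_def by (simp add: min.commute max.commute)
  \<comment> \<open>The endpoints of \<open>L\<close> go to \<open>f q\<close> and
    \<open>f (f q)\<close>, which lie on opposite sides of \<open>q\<close>.\<close>
  have KL: "K \<union> L \<subseteq> f ` L"
    using interval_image_subset[of q "f q" f] cont middle unfolding K_def L_def by auto
  have Int: "K \<inter> L \<subseteq> {q}"
    using middle unfolding K_def L_def by auto
  have notin: "f (f q) \<notin> L"
    using middle unfolding L_def by auto
  show "has_orbit_of_period_on J f m"
  proof (cases "m = 1")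
    case True
    \<comment> \<open>The loop through \<open>K\<close> needs length at least 2; a fixed point comes
      from \<open>L\<close> covering itself.\<close>
    have "L \<subseteq> f ` L"
      using KL by simp
    with cont(2) obtain x where "x \<in> L" "f x = x"
      unfolding L_def by (rule exists_fixed_point_of_interval_subset_image) auto
    then show ?thesis
      using sub True by (intro has_orbit_of_period_onI[of m x]) auto
  next
    case False
    with \<open>m > 0\<close> have m: "m \<ge> 2"
      by simp
    \<comment> \<open>\<open>y i\<close> is the endpoint other than \<open>q\<close> of the interval
      prescribed at time \<open>i\<close>.\<close>
    define y where "y i = (if i = 0 \<or> i = m then f (f q) else f q)" for i
    define I where "I i = {min q (y i)..max q (y i)}" for i
    have I: "I i = (if i = 0 \<or> i = m then K else L)" for i
      unfolding I_def y_def K_def L_def by simp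
    have "\<exists>s t. s \<le> t \<and> {s..t} \<subseteq> I 0 \<and> (\<forall>i\<le>m. (f ^^ i) ` {s..t} \<subseteq> I i) \<and> (f ^^ m) ` {s..t} = I m"
      unfolding I_def
    proof (rule exists_interval_following_itinerary, fold I_def)
      fix i assume "i < m"
      show "continuous_on (I i) f"
        using cont unfolding I by simp
      \<comment> \<open>As \<open>m \<ge> 2\<close>, the indices 0 and \<open>m\<close> are not
        adjacent, so no step from \<open>K\<close> to \<open>K\<close> occurs.\<close>
      show "I (Suc i) \<subseteq> f ` I i"
        using LK KL \<open>i < m\<close> m unfolding I by auto
    qed simp
    then obtain s t where st: "s \<le> t" "{s..t} \<subseteq> K" "(f ^^ m) ` {s..t} = K"
        and itinerary: "\<And>i. i \<le> m \<Longrightarrow> (f ^^ i) ` {s..t} \<subseteq> I i"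
      unfolding I by auto
    have "continuous_on {s..t} (f ^^ m)"
      using continuous_on_subset[OF conjunct1[OF continuous_on_funpow[OF assms(4,3)]]] st(2) sub(1)
      by simp
    then obtain x where x: "x \<in> {s..t}" "(f ^^ m) x = x"
      using exists_fixed_point_of_interval_subset_image[of s t "f ^^ m"] st by auto
    have x_L: "(f ^^ i) x \<in> L" if "0 < i" "i < m" for i
      using itinerary[of i] that x(1) unfolding I by auto
    have "(f ^^ k) x \<noteq> x" if k: "0 < k" "k < m" for k
    proof
      assume per: "(f ^^ k) x = x"
      with x_L[OF k] x(1) st(2) Int have "x = q"
        by auto
      show False
      \<comment> \<open>For \<open>m = 2\<close> only \<open>k = 1\<close> is possible, and
        \<open>q\<close> is not fixed. For larger \<open>m\<close>, time 2 is an inner one and would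
        put \<open>f (f q)\<close> into \<open>L\<close>.\<close>
      proof (cases "m = 2")
        case True
        then show False
          using k per middle \<open>x = q\<close> by (cases "k = 1") auto
      next
        case False
        then show False
          using x_L[of 2] m notin \<open>x = q\<close> by (simp add: numeral_2_eq_2)
      qed
    qed
    moreover have "x \<in> J"
      using x(1) st(2) sub(1) by blast
    ultimately show ?thesis
      using has_orbit_of_period_onI[OF \<open>m > 0\<close> _ x(2)] by simp
  qed
qed

end
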